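(* Let $A$ be an associative algebra over a field $\mathbb{K}$ and let $R,S:A\to A$ be $\mathbb{K}$-linear maps. Define $\mathbb{K}$-bilinear operations $\prec,\succ$ on $A$ by $$a\prec b = aS(b),\qquad a\succ b = R(a)b,\qquad \text{for all } a,b\in A.$$ Then: (1) If $(A,R,S)$ is a Rota-Baxter system, then $(A,\prec,\succ)$ is a dendriform algebra. (2) If $A$ is non-degenerate and $(A,\prec,\succ)$ is a dendriform algebra, then $(A,R,S)$ is a Rota-Baxter system.
   Context: Algebras are associative, not necessarily unital, over a field $\mathbb{K}$. An algebra $A$ is non-degenerate if, for every $b\in A$: ($ba=0$ for all $a\in A$) implies $b=0$, and ($ab=0$ for all $a\in A$) implies $b=0$. A Rota-Baxter system is a triple $(A,R,S)$ consisting of an algebra $A$ and two $\mathbb{K}$-linear operators $R,S:A\to A$ such that, for all $a,b\in A$, $$R(a)R(b)=R\big(R(a)b+aS(b)\big),\qquad S(a)S(b)=S\big(R(a)b+aS(b)\big).$$ A dendriform algebra is a vector space $V$ with two bilinear operations $\prec,\succ$ such that, for all $a,b,c\in V$, $$(a\prec b)\prec c=a\prec(b\prec c+b\succ c),\quad a\succ(b\prec c)=(a\succ b)\prec c,\quad a\succ(b\succ c)=(a\prec b+a\succ b)\succ c.$$ *)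

theory Defs
  imports Complex_Main
begin

text \<open>
  The type class \<^class>\<open>ring\<close> supplies an associative ring that need not have a unit; the scalar
  action is an explicit parameter because it ranges over an arbitrary field.
\<close>

locale assoc_algebra = vector_space scale
  for scale :: "'k::field \<Rightarrow> 'a::ring \<Rightarrow> 'a" +
  assumes scale_mult_left: "scale c a * b = scale c (a * b)"
    and scale_mult_right: "a * scale c b = scale c (a * b)"

text \<open>
  Non-degeneracy concerns the multiplication alone, so it is a predicate of the product and does
  not mention the scalar action.
\<close>

definition nondegenerate :: "('a::zero \<Rightarrow> 'a \<Rightarrow> 'a) \<Rightarrow> bool"
  where "nondegenerate mult \<longleftrightarrow>
    (\<forall>b. ((\<forall>a. mult b a = 0) \<longrightarrow> b = 0) \<and> ((\<forall>a. mult a b = 0) \<longrightarrow> b = 0))"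

locale rota_baxter_system = assoc_algebra scale
  for scale :: "'k::field \<Rightarrow> 'a::ring \<Rightarrow> 'a" +
  fixes R S :: "'a \<Rightarrow> 'a"
  assumes linear_R: "Vector_Spaces.linear scale scale R"
    and linear_S: "Vector_Spaces.linear scale scale S"
    and R_mult: "R a * R b = R (R a * b + a * S b)"
    and S_mult: "S a * S b = S (R a * b + a * S b)"

definition bilinear_op :: "('k::field \<Rightarrow> 'v::ab_group_add \<Rightarrow> 'v) \<Rightarrow> ('v \<Rightarrow> 'v \<Rightarrow> 'v) \<Rightarrow> bool"
  where "bilinear_op scale f \<longleftrightarrow>
    (\<forall>x. Vector_Spaces.linear scale scale (\<lambda>y. f x y)) \<and>
    (\<forall>y. Vector_Spaces.linear scale scale (\<lambda>x. f x y))"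

locale dendriform_algebra = vector_space scale
  for scale :: "'k::field \<Rightarrow> 'v::ab_group_add \<Rightarrow> 'v" +
  fixes dprec :: "'v \<Rightarrow> 'v \<Rightarrow> 'v" (infixl "\<prec>" 70)
    and dsucc :: "'v \<Rightarrow> 'v \<Rightarrow> 'v" (infixl "\<succ>" 70)
  assumes bilinear_dprec: "bilinear_op scale (\<prec>)"
    and bilinear_dsucc: "bilinear_op scale (\<succ>)"
    and dprec_dprec: "(a \<prec> b) \<prec> c = a \<prec> (b \<prec> c + b \<succ> c)"
    and dsucc_dprec: "a \<succ> (b \<prec> c) = (a \<succ> b) \<prec> c"
    and dsucc_dsucc: "a \<succ> (b \<succ> c) = (a \<prec> b + a \<succ> b) \<succ> c"

end

theory Submission
  imports Defs
begin

text \<open>With \<open>a \<prec> b = a * S b\<close> and \<open>a \<succ> b = R a * b\<close>, the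
  mixed dendriform axiom is just associativity. The other two are the Rota-Baxter identities times
  an arbitrary element: the one for \<open>S\<close> multiplied from the left, the one for
  \<open>R\<close> from the right. Multiplying gives the first implication. For the converse the
  extra factor must be cancelled, which non-degeneracy allows on either side
  (\<open>nondegenerate_eq_left\<close>, \<open>nondegenerate_eq_right\<close>).\<close>

lemma bilinear_op_iff:
  assumes "vector_space scale"
  shows "bilinear_op scale f \<longleftrightarrow>
    (\<forall>x y z. f x (y + z) = f x y + f x z) \<and> (\<forall>c x y. f x (scale c y) = scale c (f x y)) \<and>
    (\<forall>x y z. f (x + y) z = f x z + f y z) \<and> (\<forall>c x y. f (scale c x) y = scale c (f x y))"
  using assms unfolding bilinear_op_def Vector_Spaces.linear_iff by blast

text \<open>Non-degeneracy only says that annihilators vanish. By distributivity it applies to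
  \<open>x - y\<close> and so cancels a factor that ranges over the whole algebra.\<close>

lemma nondegenerate_eq_left:
  fixes x y :: "'a::ring"
  assumes "nondegenerate ((*) :: 'a \<Rightarrow> 'a \<Rightarrow> 'a)" and "\<And>a. a * x = a * y"
  shows "x = y"
proof -
  have "\<forall>a. a * (x - y) = 0"
    using assms(2) by (simp add: right_diff_distrib)
  then have "x - y = 0"
    using assms(1) unfolding nondegenerate_def by blast
  then show ?thesis by simp
qed

lemma nondegenerate_eq_right:
  fixes x y :: "'a::ring"
  assumes "nondegenerate ((*) :: 'a \<Rightarrow> 'a \<Rightarrow> 'a)" and "\<And>a. x * a = y * a"
  shows "x = y"
proof -
  have "\<forall>a. (x - y) * a = 0"
    using assms(2) by (simp add: left_diff_distrib)
  then have "x - y = 0"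
    using assms(1) unfolding nondegenerate_def by blast
  then show ?thesis by simp
qed

lemma (in rota_baxter_system) dendriform_algebra:
  "dendriform_algebra scale (\<lambda>a b. a * S b) (\<lambda>a b. R a * b)"
proof unfold_locales
  show "bilinear_op scale (\<lambda>a b. a * S b)" "bilinear_op scale (\<lambda>a b. R a * b)"
    using linear_R linear_S
    by (simp_all add: bilinear_op_iff[OF vector_space_axioms] Vector_Spaces.linear_iff
        algebra_simps scale_mult_left scale_mult_right)
next
  fix a b c
  show "a * S b * S c = a * S (b * S c + R b * c)"
    by (simp add: mult.assoc S_mult add.commute)
  show "R a * (b * S c) = R a * b * S c"
    by (simp add: mult.assoc)
  show "R a * (R b * c) = R (a * S b + R a * b) * c"
    by (simp add: mult.assoc[symmetric] R_mult add.commute)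
qed

theorem proposition2p5:
  fixes scale :: "'k::field \<Rightarrow> 'a::ring \<Rightarrow> 'a"
    and R S :: "'a \<Rightarrow> 'a"
  assumes "assoc_algebra scale"
    and "Vector_Spaces.linear scale scale R"
    and "Vector_Spaces.linear scale scale S"
  shows "(rota_baxter_system scale R S \<longrightarrow>
            dendriform_algebra scale (\<lambda>a b. a * S b) (\<lambda>a b. R a * b)) \<and>
         (nondegenerate ((*) :: 'a \<Rightarrow> 'a \<Rightarrow> 'a) \<and>
            dendriform_algebra scale (\<lambda>a b. a * S b) (\<lambda>a b. R a * b) \<longrightarrow>
            rota_baxter_system scale R S)"
proof (intro conjI impI; (elim conjE)?)
  assume "rota_baxter_system scale R S"
  then show "dendriform_algebra scale (\<lambda>a b. a * S b) (\<lambda>a b. R a * b)"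
    by (rule rota_baxter_system.dendriform_algebra)
next
  assume nondeg: "nondegenerate ((*) :: 'a \<Rightarrow> 'a \<Rightarrow> 'a)"
    and "dendriform_algebra scale (\<lambda>a b. a * S b) (\<lambda>a b. R a * b)"
  then interpret dendriform_algebra scale "\<lambda>a b. a * S b" "\<lambda>a b. R a * b"
    by simp
  have "R a * R b = R (R a * b + a * S b)" for a b
    \<comment> \<open>After right multiplication by an arbitrary \<open>c\<close>, reassociating
      yields \<open>R a * (R b * c)\<close>, the left side of \<open>dsucc_dsucc\<close>.\<close>
    by (rule nondegenerate_eq_right[OF nondeg])
      (simp add: mult.assoc dsucc_dsucc add.commute)
  moreover have "S a * S b = S (R a * b + a * S b)" for a b
    \<comment> \<open>Here the free factor stands on the left, as the first argument in
      \<open>dprec_dprec\<close>, so products are bracketed the opposite way.\<close>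
    by (rule nondegenerate_eq_left[OF nondeg])
      (simp add: mult.assoc[symmetric] dprec_dprec add.commute)
  ultimately show "rota_baxter_system scale R S"
    using assms by (simp add: rota_baxter_system_def rota_baxter_system_axioms_def)
qed

end
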